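(* For every integer $n\ge 1$, $$\hat{B}_n(x_1,\dots,x_n)=F^{[n]}_{2n-1}(x_1,\dots,x_n).$$
   Context: For an integer $r\ge 1$, the $r$-Fibonacci polynomial $F^{[r]}_m(x_1,\dots,x_r)$ is defined by $F^{[r]}_m=0$ for $0\le m<r-1$, $F^{[r]}_{r-1}=1$, and $F^{[r]}_m=\sum_{i=1}^r x_iF^{[r]}_{m-i}$ for $m\ge r$. The partial ordinary Bell polynomial is $$\hat{B}_{n,k}=\sum_{\substack{j_1+j_2+\cdots+j_{n-k+1}=k\\ j_1+2j_2+\cdots+(n-k+1)j_{n-k+1}=n}}\frac{k!}{j_1!j_2!\cdots j_{n-k+1}!}x_1^{j_1}x_2^{j_2}\cdots x_{n-k+1}^{j_{n-k+1}}$$ (sum over nonnegative integers $j_i$), and the complete ordinary Bell polynomial is $\hat{B}_n=\sum_{k=1}^n\hat{B}_{n,k}$. *)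

theory Defs
  imports "HOL-Library.Poly_Mapping" "HOL-Library.FuncSet"
begin

text \<open>
  Polynomials over \<open>'a\<close> in indeterminates indexed by \<^typ>\<open>nat\<close>: finitely supported maps from
  monomials (finitely supported exponent maps) to coefficients, with the convolution product of
  \<^theory>\<open>HOL-Library.Poly_Mapping\<close>.
\<close>

type_synonym 'a mpoly = "(nat \<Rightarrow>\<^sub>0 nat) \<Rightarrow>\<^sub>0 'a"

definition Var :: "nat \<Rightarrow> 'a::comm_ring_1 mpoly" where
  "Var i = Poly_Mapping.single (Poly_Mapping.single i 1) 1"

text \<open>
  The case distinction is on \<open>m < r - 1\<close>, \<open>m = r - 1\<close> and \<open>m \<ge> r\<close>, written without subtraction.
  Only \<open>r \<ge> 1\<close> is meaningful.
\<close>

fun fib_poly :: "nat \<Rightarrow> nat \<Rightarrow> 'a::comm_ring_1 mpoly" where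
  "fib_poly r m =
     (if m + 1 < r then 0
      else if m + 1 = r then 1
      else (\<Sum>i = 1..r. Var i * fib_poly r (m - i)))"

declare fib_poly.simps [simp del]

text \<open>
  Exponent tuples \<open>(j\<^sub>1, \<dots>, j\<^sub>n\<^sub>-\<^sub>k\<^sub>+\<^sub>1)\<close> are extensional functions on
  \<open>{1..n - k + 1}\<close>, so that each tuple is counted once.
\<close>

definition bell_exponents :: "nat \<Rightarrow> nat \<Rightarrow> (nat \<Rightarrow> nat) set" where
  "bell_exponents n k =
     {j \<in> {1..n - k + 1} \<rightarrow>\<^sub>E UNIV.
        (\<Sum>i = 1..n - k + 1. j i) = k \<and> (\<Sum>i = 1..n - k + 1. i * j i) = n}"

definition partial_bell :: "nat \<Rightarrow> nat \<Rightarrow> 'a::comm_ring_1 mpoly" where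
  "partial_bell n k =
     (\<Sum>j \<in> bell_exponents n k.
        of_nat (fact k div (\<Prod>i = 1..n - k + 1. fact (j i))) *
        (\<Prod>i = 1..n - k + 1. Var i ^ j i))"

definition complete_bell :: "nat \<Rightarrow> 'a::comm_ring_1 mpoly" where
  "complete_bell n = (\<Sum>k = 1..n. partial_bell n k)"

text \<open>
  The sum in \<^const>\<open>partial_bell\<close> is finite and the division in its coefficients is exact.
\<close>

lemma finite_bell_exponents: "finite (bell_exponents n k)"
proof (rule finite_subset)
  show "bell_exponents n k \<subseteq> {1..n - k + 1} \<rightarrow>\<^sub>E {..k}"
  proof
    fix j assume j: "j \<in> bell_exponents n k"
    have "j i \<le> k" if "i \<in> {1..n - k + 1}" for i
      using member_le_sum[OF that, of j] j by (simp add: bell_exponents_def)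
    then show "j \<in> {1..n - k + 1} \<rightarrow>\<^sub>E {..k}"
      using j by (auto simp: bell_exponents_def PiE_iff)
  qed
qed (simp add: finite_PiE)

lemma prod_fact_dvd_fact_sum:
  "finite A \<Longrightarrow> (\<Prod>i\<in>A. fact (j i) :: nat) dvd fact (\<Sum>i\<in>A. j i)"
proof (induction A rule: finite_induct)
  case (insert a A)
  have "fact (j a) * (\<Prod>i\<in>A. fact (j i) :: nat) dvd fact (j a) * fact (\<Sum>i\<in>A. j i)"
    using insert.IH by (rule mult_dvd_mono[OF dvd_refl])
  also have "\<dots> dvd fact (j a + (\<Sum>i\<in>A. j i))"
    by (rule fact_fact_dvd_fact)
  finally show ?case
    using insert.hyps by simp
qed simp

lemma bell_coefficient_exact:
  assumes "j \<in> bell_exponents n k"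
  shows "(\<Prod>i = 1..n - k + 1. fact (j i) :: nat) dvd fact k"
  using prod_fact_dvd_fact_sum[of "{1..n - k + 1}" j] assms
  by (simp add: bell_exponents_def)

end

theory Submission
  imports Defs "HOL-Computational_Algebra.Formal_Power_Series"
begin

text \<open>
  Put \<open>f = x\<^sub>1 t + \<dots> + x\<^sub>n t\<^sup>n\<close>. By the multinomial theorem the partial Bell polynomial
  \<open>B\<^sub>n\<^sub>,\<^sub>k\<close> is the coefficient of \<open>t\<^sup>n\<close> in \<open>f\<^sup>k\<close>: the variables \<open>x\<^sub>i\<close> with \<open>i > n - k + 1\<close> do not
  contribute, since the other \<open>k - 1\<close> factors have degree at least one each. The shifted Fibonacci
  series \<open>G = (\<Sum>m. F\<^sub>n\<^sub>-\<^sub>1\<^sub>+\<^sub>m t\<^sup>m)\<close> satisfies \<open>(1 - f) G = 1\<close>, so it agrees with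
  \<open>1 + f + \<dots> + f\<^sup>n\<close> modulo \<open>t\<^sup>n\<^sup>+\<^sup>1\<close>.
\<close>

text \<open>Splits one binomial factor off a multinomial coefficient. The divisibility assumption
  keeps the division of natural numbers exact.\<close>

lemma fact_div_mult_eq_choose_mult:
  fixes P :: nat
  assumes "m \<le> k" "P dvd fact (k - m)"
  shows "fact k div (fact m * P) = (k choose m) * (fact (k - m) div P)"
proof -
  have "fact k = fact m * fact (k - m) * (k choose m)"
    using binomial_fact_lemma[OF assms(1)] by simp
  then have "fact k div (fact m * P) = (fact (k - m) * (k choose m)) div P"
    by (simp add: mult.assoc)
  then show ?thesis
    using assms(2) by (simp add: div_mult_swap mult.commute)
qed

text \<open>Keeps only the degree condition of \<open>bell_exponents\<close>, over an arbitrary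
  index set, so that induction on that set is possible.\<close>

definition exponents_of_degree :: "'i set \<Rightarrow> nat \<Rightarrow> ('i \<Rightarrow> nat) set" where
  "exponents_of_degree S k = {j \<in> S \<rightarrow>\<^sub>E UNIV. (\<Sum>i\<in>S. j i) = k}"

lemma finite_exponents_of_degree:
  assumes "finite S"
  shows "finite (exponents_of_degree S k)"
proof (rule finite_subset)
  show "exponents_of_degree S k \<subseteq> S \<rightarrow>\<^sub>E {..k}"
    using assms by (auto simp: exponents_of_degree_def PiE_iff intro: member_le_sum extensional_arb)
qed (simp add: finite_PiE assms)

lemma exponents_of_degree_sum_insert:
  fixes h :: "('i \<Rightarrow> nat) \<Rightarrow> 'b::comm_monoid_add"
  assumes "finite S" "a \<notin> S"
  shows "(\<Sum>j\<in>exponents_of_degree (insert a S) k. h j) =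
         (\<Sum>m\<le>k. \<Sum>j\<in>exponents_of_degree S (k - m). h (j(a := m)))"
proof -
  have sum_upd: "sum (j(a := m)) S = sum j S" "(\<Sum>x\<in>S. if x = a then m else j x) = sum j S"
    for j :: "'i \<Rightarrow> nat" and m
    using assms(2) by (auto intro!: sum.cong)
  have "(\<Sum>j\<in>exponents_of_degree (insert a S) k. h j) =
        (\<Sum>(m, j)\<in>(SIGMA m:{..k}. exponents_of_degree S (k - m)). h (j(a := m)))"
  \<comment> \<open>A tuple on \<open>insert a S\<close> is split into its value at \<open>a\<close>
    and the rest. Resetting \<open>a\<close> to \<open>undefined\<close> makes the rest extensional
    on \<open>S\<close>.\<close>
  proof (rule sum.reindex_bij_witness[where i = "\<lambda>(m, j). j(a := m)"
        and j = "\<lambda>j. (j a, j(a := undefined))"])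
    fix p assume "p \<in> (SIGMA m:{..k}. exponents_of_degree S (k - m))"
    then obtain m j where p: "p = (m, j)" "m \<le> k" "j \<in> exponents_of_degree S (k - m)"
      by auto
    then have "j a = undefined"
      using assms(2) by (auto simp: exponents_of_degree_def PiE_iff extensional_def)
    then show "(case (case p of (m, j) \<Rightarrow> j(a := m)) of j \<Rightarrow> (j a, j(a := undefined))) = p"
      using p by (auto simp: fun_eq_iff)
    show "(case p of (m, j) \<Rightarrow> j(a := m)) \<in> exponents_of_degree (insert a S) k"
      using p assms by (auto simp: exponents_of_degree_def sum_upd PiE_iff extensional_def)
  qed (use assms in \<open>auto simp: exponents_of_degree_def sum_upd PiE_iff extensional_def\<close>)
  then show ?thesis
    by (simp add: sum.Sigma finite_exponents_of_degree assms)
qed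

text \<open>Induction on \<open>S\<close>: the binomial theorem separates \<open>y a\<close>, and
  the induction hypothesis at exponent \<open>k - m\<close> expands the power of the remaining
  sum.\<close>

theorem multinomial_theorem:
  fixes y :: "'i \<Rightarrow> 'b::comm_ring_1"
  assumes "finite S"
  shows "(\<Sum>i\<in>S. y i) ^ k =
         (\<Sum>j\<in>exponents_of_degree S k.
            of_nat (fact k div (\<Prod>i\<in>S. fact (j i))) * (\<Prod>i\<in>S. y i ^ j i))"
  using assms
proof (induction S arbitrary: k rule: finite_induct)
  case empty
  show ?case
    by (cases k) (auto simp: exponents_of_degree_def)
next
  case (insert a S)
  have term_eq: "of_nat (k choose m) * y a ^ m *
          (of_nat (fact (k - m) div (\<Prod>i\<in>S. fact (j i))) * (\<Prod>i\<in>S. y i ^ j i)) =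
        of_nat (fact k div (\<Prod>i\<in>insert a S. fact ((j(a := m)) i))) *
          (\<Prod>i\<in>insert a S. y i ^ (j(a := m)) i)"
    if "m \<le> k" "j \<in> exponents_of_degree S (k - m)" for m j
  proof -
    have "(\<Prod>i\<in>S. fact (j i) :: nat) dvd fact (k - m)"
      using prod_fact_dvd_fact_sum[OF insert.hyps(1), of j] that(2)
      by (simp add: exponents_of_degree_def)
    note coeff = fact_div_mult_eq_choose_mult[OF that(1) this]
    have "(\<Prod>i\<in>S. fact ((j(a := m)) i) :: nat) = (\<Prod>i\<in>S. fact (j i))"
      "(\<Prod>i\<in>S. y i ^ (j(a := m)) i) = (\<Prod>i\<in>S. y i ^ j i)"
      using insert.hyps(2) by (auto intro!: prod.cong)
    then show ?thesis
      \<comment> \<open>Keeping \<open>j(a := m)\<close> folded lets the two product equations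
        rewrite first; the second call evaluates the update at \<open>a\<close>.\<close>
      using insert.hyps by (simp add: coeff mult_ac del: fun_upd_apply) (simp add: coeff mult_ac)
  qed
  have "(\<Sum>i\<in>insert a S. y i) ^ k =
        (\<Sum>m\<le>k. of_nat (k choose m) * y a ^ m * (\<Sum>i\<in>S. y i) ^ (k - m))"
    using insert.hyps by (simp add: binomial_ring)
  also have "\<dots> = (\<Sum>m\<le>k. \<Sum>j\<in>exponents_of_degree S (k - m).
        of_nat (fact k div (\<Prod>i\<in>insert a S. fact ((j(a := m)) i))) *
          (\<Prod>i\<in>insert a S. y i ^ (j(a := m)) i))"
    unfolding insert.IH sum_distrib_left by (intro sum.cong refl term_eq) auto
  also have "\<dots> = (\<Sum>j\<in>exponents_of_degree (insert a S) k.
        of_nat (fact k div (\<Prod>i\<in>insert a S. fact (j i))) * (\<Prod>i\<in>insert a S. y i ^ j i))"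
    by (rule exponents_of_degree_sum_insert[OF insert.hyps, symmetric])
  finally show ?case .
qed

text \<open>The cutoff is a parameter because \<open>partial_bell n k\<close> involves
  \<open>n - k + 1\<close> variables, whereas the Fibonacci recurrence involves
  \<open>r\<close>.\<close>

definition var_series :: "nat \<Rightarrow> 'a::comm_ring_1 mpoly fps" where
  "var_series N = (\<Sum>i = 1..N. fps_const (Var i) * fps_X ^ i)"

lemma fps_const_prod:
  fixes c :: "'i \<Rightarrow> 'b::comm_ring_1"
  shows "(\<Prod>i\<in>S. fps_const (c i)) = fps_const (\<Prod>i\<in>S. c i)"
  by (induction S rule: infinite_finite_induct) auto

text \<open>In the multinomial expansion the tuple \<open>j\<close> carries \<open>fps_X\<close> to
  the weighted sum of its entries, so extracting coefficient \<open>n\<close> imposes the second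
  condition of \<open>bell_exponents\<close>.\<close>

lemma partial_bell_eq_nth_power:
  "(partial_bell n k :: 'a::comm_ring_1 mpoly) = fps_nth (var_series (n - k + 1) ^ k) n"
proof -
  let ?S = "{1..n - k + 1}"
  let ?c = "\<lambda>j. of_nat (fact k div (\<Prod>i\<in>?S. fact (j i))) * (\<Prod>i\<in>?S. Var i ^ j i) :: 'a mpoly"
  have monomial: "of_nat (fact k div (\<Prod>i\<in>?S. fact (j i))) *
        (\<Prod>i\<in>?S. (fps_const (Var i) * fps_X ^ i) ^ j i) =
      fps_const (?c j) * fps_X ^ (\<Sum>i\<in>?S. i * j i)" for j
  proof -
    have "(\<Prod>i\<in>?S. (fps_const (Var i :: 'a mpoly) * fps_X ^ i) ^ j i) =
        fps_const (\<Prod>i\<in>?S. Var i ^ j i) * fps_X ^ (\<Sum>i\<in>?S. i * j i)"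
      by (simp only: power_mult_distrib prod.distrib fps_const_prod fps_const_power power_sum power_mult)
    then show ?thesis
      by (simp add: fps_of_nat[symmetric] mult.assoc[symmetric])
  qed
  have "fps_nth (var_series (n - k + 1) ^ k) n =
      (\<Sum>j\<in>exponents_of_degree ?S k. if (\<Sum>i\<in>?S. i * j i) = n then ?c j else 0)"
    unfolding var_series_def multinomial_theorem[OF finite_atLeastAtMost] monomial fps_sum_nth
    by (intro sum.cong refl) (simp add: fps_X_power_nth)
  also have "\<dots> = (\<Sum>j\<in>bell_exponents n k. ?c j)"
    by (simp add: finite_exponents_of_degree flip: sum.inter_filter)
      (simp add: bell_exponents_def exponents_of_degree_def conj_assoc)
  finally show ?thesis
    by (simp add: partial_bell_def)
qed

lemma fps_X_dvd_var_series: "fps_X dvd (var_series N :: 'a::comm_ring_1 mpoly fps)"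
  unfolding var_series_def by (intro dvd_sum dvd_mult dvd_power) auto

lemma fps_nth_eq_0_if_fps_X_power_dvd:
  fixes f :: "'b::comm_ring_1 fps"
  assumes "fps_X ^ m dvd f" "n < m"
  shows "fps_nth f n = 0"
  using assms by (auto elim!: dvdE simp: fps_X_power_mult_nth)

text \<open>The difference of the \<open>k\<close>-th powers is the difference of the series, which
  has no terms below degree \<open>n - k + 2\<close>, times a sum of products of
  \<open>k - 1\<close> series divisible by \<open>fps_X\<close>. Hence its coefficient at
  \<open>n\<close> vanishes.\<close>

lemma nth_power_var_series_cong:
  assumes "1 \<le> k" "n - k + 1 \<le> N"
  shows "fps_nth (var_series N ^ k :: 'a::comm_ring_1 mpoly fps) n =
         fps_nth (var_series (n - k + 1) ^ k) n"
proof -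
  let ?M = "n - k + 1"
  let ?f = "var_series N :: 'a mpoly fps" and ?g = "var_series ?M :: 'a mpoly fps"
  have "{1..N} = {1..?M} \<union> {?M + 1..N}"
    using assms(2) by auto
  then have "?f - ?g = (\<Sum>i = ?M + 1..N. fps_const (Var i) * fps_X ^ i)"
    unfolding var_series_def by (simp add: sum.union_disjoint)
  then have head: "fps_X ^ (?M + 1) dvd ?f - ?g"
    by (simp only:) (intro dvd_sum dvd_mult le_imp_power_dvd, simp)
  have "fps_X ^ (k - 1) dvd ?g ^ (k - Suc i) * ?f ^ i" if "i < k" for i
  proof -
    have "fps_X ^ (k - Suc i) * fps_X ^ i dvd ?g ^ (k - Suc i) * ?f ^ i"
      by (intro mult_dvd_mono dvd_power_same fps_X_dvd_var_series)
    then show ?thesis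
      using that by (simp flip: power_add)
  qed
  then have "fps_X ^ (k - 1) dvd (\<Sum>i<k. ?g ^ (k - Suc i) * ?f ^ i)"
    by (auto intro: dvd_sum)
  with head have "fps_X ^ (?M + 1) * fps_X ^ (k - 1) dvd ?f ^ k - ?g ^ k"
    unfolding power_diff_sumr2 by (rule mult_dvd_mono)
  moreover have "?M + 1 + (k - 1) > n"
    using assms(1) by simp
  ultimately have "fps_nth (?f ^ k - ?g ^ k) n = 0"
    unfolding power_add[symmetric] by (rule fps_nth_eq_0_if_fps_X_power_dvd)
  then show ?thesis
    by simp
qed

text \<open>The offset \<open>r - 1\<close> skips the initial zeros, so the constant term is 1 for
  \<open>r \<ge> 1\<close>.\<close>

definition fib_series :: "nat \<Rightarrow> 'a::comm_ring_1 mpoly fps" where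
  "fib_series r = Abs_fps (\<lambda>m. fib_poly r (r - 1 + m))"

lemma fib_series_inverse:
  assumes "1 \<le> r"
  shows "(1 - var_series r) * fib_series r = (1 :: 'a::comm_ring_1 mpoly fps)"
proof -
  have "fib_series r = 1 + var_series r * (fib_series r :: 'a mpoly fps)"
  proof (rule fps_ext)
    fix m
    \<comment> \<open>For \<open>i > m\<close> the left side is 0 and the right side is one of the
      initial zeros. Since \<open>m > 0\<close> and \<open>i \<le> r\<close>, the subtraction of
      \<open>i\<close> is never truncated.\<close>
    have shift: "fps_nth (fps_X ^ i * fib_series r) m = (fib_poly r (r - 1 + m - i) :: 'a mpoly)"
      if "m > 0" "i \<in> {1..r}" for i
      using that by (auto simp: fps_X_power_mult_nth fib_series_def fib_poly.simps[of r "r + m - Suc i"]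
          fib_poly.simps[of r "r - Suc 0"])
    show "fps_nth (fib_series r) m =
        fps_nth (1 + var_series r * (fib_series r :: 'a mpoly fps)) m"
    proof (cases "m = 0")
      case True
      have "fps_nth (var_series r :: 'a mpoly fps) 0 = 0"
        by (auto simp: var_series_def fps_sum_nth fps_X_power_nth intro!: sum.neutral)
      with True assms show ?thesis
        by (simp add: fib_series_def fib_poly.simps[of r "r - Suc 0"])
    next
      case False
      then have "fps_nth (var_series r * fib_series r) m =
          (\<Sum>i = 1..r. Var i * (fib_poly r (r - 1 + m - i) :: 'a mpoly))"
        by (simp add: var_series_def sum_distrib_right fps_sum_nth mult.assoc shift)
      with False assms show ?thesis
        by (simp add: fib_series_def fib_poly.simps[of r "r + m - Suc 0"])
    qed
  qed
  then show ?thesis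
    by (simp add: algebra_simps)
qed

text \<open>Multiplying the finite geometric sum of \<open>var_series r\<close> by
  \<open>fib_series r\<close> cancels \<open>1 - var_series r\<close>. The remainder contains the
  power \<open>Suc n\<close> of \<open>var_series r\<close> and so has no coefficient at
  \<open>n\<close>.\<close>

lemma nth_fib_series:
  assumes "1 \<le> r"
  shows "(fps_nth (fib_series r) n :: 'a::comm_ring_1 mpoly) =
         (\<Sum>k\<le>n. fps_nth (var_series r ^ k) n)"
proof -
  let ?f = "var_series r :: 'a mpoly fps" and ?G = "fib_series r :: 'a mpoly fps"
  have "?G - ?G * ?f ^ Suc n = ?G * ((1 - ?f) * (\<Sum>k<Suc n. ?f ^ k))"
    by (simp only: one_diff_power_eq[symmetric] right_diff_distrib mult_1_right)
  also have "\<dots> = ((1 - ?f) * ?G) * (\<Sum>k<Suc n. ?f ^ k)"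
    by (simp only: mult_ac)
  also have "\<dots> = (\<Sum>k\<le>n. ?f ^ k)"
    by (simp only: fib_series_inverse[OF assms] mult_1_left lessThan_Suc_atMost)
  finally have "fps_nth ?G n - fps_nth (?G * ?f ^ Suc n) n = (\<Sum>k\<le>n. fps_nth (?f ^ k) n)"
    by (metis fps_sub_nth fps_sum_nth)
  moreover have "fps_nth (?G * ?f ^ Suc n) n = 0"
    by (rule fps_nth_eq_0_if_fps_X_power_dvd[of "Suc n"])
      (intro dvd_mult dvd_power_same fps_X_dvd_var_series, simp)
  ultimately show ?thesis
    by simp
qed

theorem theorem5p3:
  fixes n :: nat
  assumes "n \<ge> 1"
  shows "(complete_bell n :: 'a::comm_ring_1 mpoly) = fib_poly n (2 * n - 1)"
proof -
  have "(complete_bell n :: 'a mpoly) = (\<Sum>k = 1..n. fps_nth (var_series n ^ k) n)"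
    unfolding complete_bell_def partial_bell_eq_nth_power
    by (intro sum.cong refl nth_power_var_series_cong[symmetric]) auto
  \<comment> \<open>The added term \<open>k = 0\<close> is the coefficient of the constant series 1
    at \<open>n \<ge> 1\<close>, hence 0.\<close>
  also have "\<dots> = (\<Sum>k\<le>n. fps_nth (var_series n ^ k) n)"
    using assms by (intro sum.mono_neutral_left) (auto simp: not_less_eq_eq)
  also have "\<dots> = fps_nth (fib_series n) n"
    by (rule nth_fib_series[OF assms, symmetric])
  also have "\<dots> = fib_poly n (2 * n - 1)"
    using assms by (simp add: fib_series_def mult_2)
  finally show ?thesis .
qed

end
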